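(* Let $r$ be a non-degenerate coalgebra automorphism of $D\otimes D$ inducing a non-degenerate solution $r_{|}$ of the set-theoretic braid equation on $X$, and assume that there are two commuting order automorphisms $\phi_l,\phi_r\colon X\to X$ such that ${}^x(-)=\phi_l$ and $(-)^y=\phi_r$ for all $x,y\in X$. Let $n\in\mathbb N$. Assume that $\phi_r^n=\phi_l^n=\mathrm{id}$ and that each element of $K^\times$ has $n$ distinct $n$th roots in $K$, and fix a primitive $n$th root of unity $w$. The following facts hold (with $\alpha_r,\beta_r,\alpha_l,\beta_l$ and $\sim$ as in the context; whenever a pair $a\prec b$ is fixed, $\alpha_r(s),\beta_r(s),\alpha_l(s),\beta_l(s)$ without further arguments mean the values at $(a,b)$). 1) The equality $$\alpha_r(c)(a,b)\,\alpha_r(e)(a^{(1)},b^{(1)})=\alpha_r({}^{(1)}e)(a,b)\,\alpha_r(c^{(1)})(a^{(1)},b^{(1)})$$ holds for all $a\prec b$ and all $c,e$ in $X$ if and only if for all $a\prec b$ in $X$ there exists a constant $C_r(a,b)\in K^\times$ such that $\alpha_r^{(1)}(s)/\alpha_r(s)=C_r(a,b)$ and $\alpha_r(s)=\alpha_r({}^{(1)}s^{(1)})$ for all $s\in X$. 2) The equality $$\alpha_l(a^{(1)})(e,f)\,\alpha_l({}^{(1)}c)({}^{(1)}e,{}^{(1)}f)=\alpha_l(c)(e,f)\,\alpha_l(a)({}^{(1)}e,{}^{(1)}f)$$ holds for all $e\prec f$ and all $a,c$ in $X$ if and only if for all $a\prec b$ in $X$ there exists a constant $C_l(a,b)\in K^\times$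 such that $\alpha_l^{(1)}(s)/\alpha_l(s)=C_l(a,b)$ and $\alpha_l(s)=\alpha_l({}^{(1)}s^{(1)})$ for all $s\in X$. 3) Assume that the equivalent conditions in 1) are fulfilled. Then the equality $$\beta_r(c)(a,b)+\alpha_r(c)(a,b)\,\beta_r(e)(a^{(1)},b^{(1)})=\beta_r({}^{(1)}e)(a,b)+\alpha_r({}^{(1)}e)(a,b)\,\beta_r(c^{(1)})(a^{(1)},b^{(1)})$$ holds for all $a\prec b$ and all $c,e$ in $X$ if and only if $\beta_r(s)=\beta_r({}^{(1)}s^{(1)})$ for all $s\in X$ and $a\prec b$ in $X$, and for all $a,b,s,t\in X$ with $a\prec b$ and each $0\le i<n$, $$\Bigl(\gamma_r\alpha_r(s)-w^i,\ \sum_{j=0}^{n-1}\wp_j w^{ij}\beta_r^{(j)}(s)\Bigr)\sim\Bigl(\gamma_r\alpha_r(t)-w^i,\ \sum_{j=0}^{n-1}\wp_j w^{ij}\beta_r^{(j)}(t)\Bigr),$$ where $\gamma_r$ is a fixed $n$th root of $\prod_{u=0}^{n-2}C_r(a^{(u)},b^{(u)})^{n-u-1}$ and $$\wp_j=\frac{1}{\gamma_r^{j+1}}\prod_{u=0}^{n-2}C_r(a^{(u)},b^{(u)})\prod_{u=0}^{j-2}C_r(a^{(u)},b^{(u)})^{j-u-1}.$$ 4) Assume that the equivalent conditions in 2) are fulfilled. Then the equality $$\beta_l(a^{(1)})(e,f)+\alpha_l(a^{(1)})(e,f)\,\beta_l({}^{(1)}c)({}^{(1)}e,{}^{(1)}f)=\beta_l(c)(e,f)+\alpha_l(c)(e,f)\,\beta_l(a)({}^{(1)}e,{}^{(1)}f)$$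 holds for all $e\prec f$ and all $a,c$ in $X$ if and only if $\beta_l(s)=\beta_l({}^{(1)}s^{(1)})$ for all $s\in X$ and $a\prec b$ in $X$, and for all $a,b,s,t\in X$ with $a\prec b$ and each $0\le i<n$, $$\Bigl(\gamma_l\alpha_l(s)-w^i,\ \sum_{j=0}^{n-1}\ell_j w^{ij}\beta_l^{(j)}(s)\Bigr)\sim\Bigl(\gamma_l\alpha_l(t)-w^i,\ \sum_{j=0}^{n-1}\ell_j w^{ij}\beta_l^{(j)}(t)\Bigr),$$ where $\gamma_l$ is a fixed $n$th root of $\prod_{u=0}^{n-2}C_l({}^{(u)}a,{}^{(u)}b)^{n-u-1}$ and $$\ell_j=\frac{1}{\gamma_l^{j+1}}\prod_{u=0}^{n-2}C_l({}^{(u)}a,{}^{(u)}b)\prod_{u=0}^{j-2}C_l({}^{(u)}a,{}^{(u)}b)^{j-u-1}.$$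
   Context: $K$ is a field and $\otimes=\otimes_K$. $(X,\le)$ is a locally finite poset (every interval $[a,b]=\{c:a\le c\le b\}$ is finite); $a\prec b$ means that $b$ covers $a$, i.e. $a<b$ and $[a,b]=\{a,b\}$. $Y=\{(a,b): a\le b\}$ and $D=KY$ is the incidence coalgebra, $\Delta(a,b)=\sum_{c\in[a,b]}(a,c)\otimes(c,b)$, $\epsilon(a,b)=\delta_{ab}$. For a linear map $r$ of $D\otimes D$, the scalars $\lambda_{a|b|c|d}^{e|f|g|h}$ are defined by $r((a,b)\otimes(c,d))=\sum_{e\le f,\ g\le h}\lambda_{a|b|c|d}^{e|f|g|h}(e,f)\otimes(g,h)$. A coalgebra automorphism $r$ of $D\otimes D$ is non-degenerate if, with $\sigma=(D\otimes\epsilon)\circ r$, $\tau=(\epsilon\otimes D)\circ r$, there are linear maps $\bar\sigma,\bar\tau\colon D\otimes D\to D$ with $\bar\sigma\circ(D\otimes\sigma)\circ(\Delta\otimes D)=\sigma\circ(D\otimes\bar\sigma)\circ(\Delta\otimes D)=\epsilon\otimes D$ and $\bar\tau\circ(\tau\otimes D)\circ(D\otimes\Delta)=\tau\circ(\bar\tau\otimes D)\circ(D\otimes\Delta)=D\otimes\epsilon$. Such an $r$ induces a bijection $r_{|}(a,c)=({}^a c,a^c)$ of $X\times X$ by $r((a,a)\otimes(c,c))=({}^a c,{}^a c)\otimes(a^c,a^c)$; the maps ${}^a(-)$ and $(-)^c$ are bijections of $X$ (non-degeneracy of $r_|$). $r_{|}$ is a solution of the set-theoretic braid equation if $(r_{|})_{12}(r_{|})_{23}(r_{|})_{12}=(r_{|})_{23}(r_{|})_{12}(r_{|})_{23}$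 on $X^3$. For $s\in X$ and $i\in\mathbb Z$ put $s^{(i)}=\phi_r^i(s)$, ${}^{(i)}s=\phi_l^i(s)$ and ${}^{(1)}s^{(1)}=\phi_l(\phi_r(s))$. For $s,a,b\in X$ with $a\prec b$ put $$\alpha_r(s)(a,b)=\lambda_{a|b|s|s}^{{}^{(1)}s|{}^{(1)}s|a^{(1)}|b^{(1)}},\quad \beta_r(s)(a,b)=\lambda_{a|b|s|s}^{{}^{(1)}s|{}^{(1)}s|a^{(1)}|a^{(1)}},$$ $$\alpha_l(s)(a,b)=\lambda_{s|s|a|b}^{{}^{(1)}a|{}^{(1)}b|s^{(1)}|s^{(1)}},\quad \beta_l(s)(a,b)=\lambda_{s|s|a|b}^{{}^{(1)}a|{}^{(1)}a|s^{(1)}|s^{(1)}}.$$ For fixed $a\prec b$: $\alpha_r^{(i)}(s)=\alpha_r(s^{(i)})(a^{(i)},b^{(i)})$, $\beta_r^{(i)}(s)=\beta_r(s^{(i)})(a^{(i)},b^{(i)})$, $\alpha_l^{(i)}(s)=\alpha_l({}^{(i)}s)({}^{(i)}a,{}^{(i)}b)$, $\beta_l^{(i)}(s)=\beta_l({}^{(i)}s)({}^{(i)}a,{}^{(i)}b)$. The scalars $\alpha_r(s)(a,b)$ and $\alpha_l(s)(a,b)$ are all nonzero. For $v,v'\in K^2$, $v\sim v'$ ("aligned") means that the determinant of the $2\times2$ matrix with rows $v,v'$ is zero. Empty products equal $1$. *)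

theory Defs
  imports Complex_Main "HOL-Library.Poly_Mapping"
begin

text \<open>The vector space with basis \<^typ>\<open>'a\<close> over the field \<^typ>\<open>'k\<close> is
  \<^typ>\<open>'a \<Rightarrow>\<^sub>0 'k\<close>.  The tensor product of the spaces with bases \<^typ>\<open>'a\<close> and \<^typ>\<open>'b\<close>
  is taken to be the space with basis \<^typ>\<open>'a \<times> 'b\<close>.\<close>

definition vscale :: "'k::field \<Rightarrow> ('a \<Rightarrow>\<^sub>0 'k) \<Rightarrow> ('a \<Rightarrow>\<^sub>0 'k)" where
  "vscale t u = Poly_Mapping.map ((*) t) u"

lemma lookup_vscale [simp]: "Poly_Mapping.lookup (vscale t u) x = t * Poly_Mapping.lookup u x"
  by (simp add: vscale_def Poly_Mapping.map.rep_eq when_def)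

lemma vector_space_vscale: "vector_space (vscale :: 'k::field \<Rightarrow> ('a \<Rightarrow>\<^sub>0 'k) \<Rightarrow> _)"
  by unfold_locales (auto intro!: poly_mapping_eqI simp: lookup_add algebra_simps)

definition bas :: "'a \<Rightarrow> ('a \<Rightarrow>\<^sub>0 'k::field)" where
  "bas x = Poly_Mapping.single x 1"

definition linear_map :: "(('a \<Rightarrow>\<^sub>0 'k::field) \<Rightarrow> ('b \<Rightarrow>\<^sub>0 'k)) \<Rightarrow> bool" where
  "linear_map f \<longleftrightarrow> Vector_Spaces.linear vscale vscale f"

definition lin_ext :: "('a \<Rightarrow> ('b \<Rightarrow>\<^sub>0 'k::field)) \<Rightarrow> ('a \<Rightarrow>\<^sub>0 'k) \<Rightarrow> ('b \<Rightarrow>\<^sub>0 'k)" where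
  "lin_ext h u = (\<Sum>x\<in>Poly_Mapping.keys u. vscale (Poly_Mapping.lookup u x) (h x))"

definition tensor :: "('a \<Rightarrow>\<^sub>0 'k::field) \<Rightarrow> ('b \<Rightarrow>\<^sub>0 'k) \<Rightarrow> (('a \<times> 'b) \<Rightarrow>\<^sub>0 'k)" where
  "tensor u v = lin_ext (\<lambda>x. lin_ext (\<lambda>y. bas (x, y)) v) u"

text \<open>Only the values of \<open>f\<close> and \<open>g\<close> on the bases enter, so this is \<open>f \<otimes> g\<close> for linear \<open>f\<close>, \<open>g\<close>.\<close>

definition tensor_map :: "(('a \<Rightarrow>\<^sub>0 'k::field) \<Rightarrow> ('c \<Rightarrow>\<^sub>0 'k)) \<Rightarrow> (('b \<Rightarrow>\<^sub>0 'k) \<Rightarrow> ('d \<Rightarrow>\<^sub>0 'k))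
    \<Rightarrow> (('a \<times> 'b) \<Rightarrow>\<^sub>0 'k) \<Rightarrow> (('c \<times> 'd) \<Rightarrow>\<^sub>0 'k)" where
  "tensor_map f g = lin_ext (\<lambda>(x, y). tensor (f (bas x)) (g (bas y)))"

text \<open>For a linear functional \<open>e\<close>, the maps \<open>id \<otimes> e\<close> and \<open>e \<otimes> id\<close>, composed with the
  canonical isomorphisms \<open>V \<otimes> K = V = K \<otimes> V\<close>.\<close>

definition id_tensor_fun :: "(('b \<Rightarrow>\<^sub>0 'k::field) \<Rightarrow> 'k) \<Rightarrow> (('a \<times> 'b) \<Rightarrow>\<^sub>0 'k) \<Rightarrow> ('a \<Rightarrow>\<^sub>0 'k)" where
  "id_tensor_fun e = lin_ext (\<lambda>(x, y). vscale (e (bas y)) (bas x))"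

definition fun_tensor_id :: "(('a \<Rightarrow>\<^sub>0 'k::field) \<Rightarrow> 'k) \<Rightarrow> (('a \<times> 'b) \<Rightarrow>\<^sub>0 'k) \<Rightarrow> ('b \<Rightarrow>\<^sub>0 'k)" where
  "fun_tensor_id e = lin_ext (\<lambda>(x, y). vscale (e (bas x)) (bas y))"

definition assoc_r :: "((('a \<times> 'b) \<times> 'c) \<Rightarrow>\<^sub>0 'k::field) \<Rightarrow> (('a \<times> ('b \<times> 'c)) \<Rightarrow>\<^sub>0 'k)" where
  "assoc_r = lin_ext (\<lambda>((x, y), z). bas (x, (y, z)))"

definition assoc_l :: "(('a \<times> ('b \<times> 'c)) \<Rightarrow>\<^sub>0 'k::field) \<Rightarrow> ((('a \<times> 'b) \<times> 'c) \<Rightarrow>\<^sub>0 'k)" where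
  "assoc_l = lin_ext (\<lambda>(x, (y, z)). bas ((x, y), z))"

definition mid_swap :: "((('a \<times> 'b) \<times> ('c \<times> 'd)) \<Rightarrow>\<^sub>0 'k::field)
    \<Rightarrow> ((('a \<times> 'c) \<times> ('b \<times> 'd)) \<Rightarrow>\<^sub>0 'k)" where
  "mid_swap = lin_ext (\<lambda>((x, y), (z, t)). bas ((x, z), (y, t)))"

definition locally_finite :: "'x::order itself \<Rightarrow> bool" where
  "locally_finite _ \<longleftrightarrow> (\<forall>a b :: 'x. finite {a..b})"

definition covers :: "'x::order \<Rightarrow> 'x \<Rightarrow> bool" (infix \<open>\<prec>\<close> 50) where
  "a \<prec> b \<longleftrightarrow> a < b \<and> {a..b} = {a, b}"

definition order_automorphism :: "('x::order \<Rightarrow> 'x) \<Rightarrow> bool" where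
  "order_automorphism \<phi> \<longleftrightarrow> bij \<phi> \<and> (\<forall>x y. \<phi> x \<le> \<phi> y \<longleftrightarrow> x \<le> y)"

typedef (overloaded) 'x intv = "{(a :: 'x::order, b). a \<le> b}"
  by auto

text \<open>Only meaningful for \<open>a \<le> b\<close>.\<close>

definition intv :: "'x::order \<Rightarrow> 'x \<Rightarrow> 'x intv" where
  "intv a b = Abs_intv (a, b)"

type_synonym ('x, 'k) incidence = "'x intv \<Rightarrow>\<^sub>0 'k"
type_synonym ('x, 'k) incidence2 = "('x intv \<times> 'x intv) \<Rightarrow>\<^sub>0 'k"

definition comult :: "('x::order, 'k::field) incidence \<Rightarrow> ('x, 'k) incidence2" where
  "comult = lin_ext (\<lambda>i. let (a, b) = Rep_intv i in \<Sum>c\<in>{a..b}. bas (intv a c, intv c b))"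

definition counit :: "('x::order, 'k::field) incidence \<Rightarrow> 'k" where
  "counit u = (\<Sum>i\<in>Poly_Mapping.keys u. Poly_Mapping.lookup u i *
     (let (a, b) = Rep_intv i in if a = b then 1 else 0))"

definition comult2 :: "('x::order, 'k::field) incidence2
    \<Rightarrow> (('x intv \<times> 'x intv) \<times> ('x intv \<times> 'x intv)) \<Rightarrow>\<^sub>0 'k" where
  "comult2 = mid_swap \<circ> tensor_map comult comult"

definition counit2 :: "('x::order, 'k::field) incidence2 \<Rightarrow> 'k" where
  "counit2 = counit \<circ> id_tensor_fun counit"

definition coalgebra_automorphism ::
    "(('x::order, 'k::field) incidence2 \<Rightarrow> ('x, 'k) incidence2) \<Rightarrow> bool" where
  "coalgebra_automorphism r \<longleftrightarrow> linear_map r \<and> bij r \<and>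
     comult2 \<circ> r = tensor_map r r \<circ> comult2 \<and> counit2 \<circ> r = counit2"

definition nondegenerate ::
    "(('x::order, 'k::field) incidence2 \<Rightarrow> ('x, 'k) incidence2) \<Rightarrow> bool" where
  "nondegenerate r \<longleftrightarrow>
    (let \<sigma> = id_tensor_fun counit \<circ> r; \<tau> = fun_tensor_id counit \<circ> r in
      (\<exists>\<sigma>' :: ('x, 'k) incidence2 \<Rightarrow> ('x, 'k) incidence. linear_map \<sigma>' \<and>
        \<sigma>' \<circ> tensor_map id \<sigma> \<circ> assoc_r \<circ> tensor_map comult id = fun_tensor_id counit \<and>
        \<sigma> \<circ> tensor_map id \<sigma>' \<circ> assoc_r \<circ> tensor_map comult id = fun_tensor_id counit) \<and>
      (\<exists>\<tau>' :: ('x, 'k) incidence2 \<Rightarrow> ('x, 'k) incidence. linear_map \<tau>' \<and>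
        \<tau>' \<circ> tensor_map \<tau> id \<circ> assoc_l \<circ> tensor_map id comult = id_tensor_fun counit \<and>
        \<tau> \<circ> tensor_map \<tau>' id \<circ> assoc_l \<circ> tensor_map id comult = id_tensor_fun counit))"

definition induces ::
    "(('x::order, 'k::field) incidence2 \<Rightarrow> ('x, 'k) incidence2) \<Rightarrow> ('x \<times> 'x \<Rightarrow> 'x \<times> 'x) \<Rightarrow> bool" where
  "induces r \<rho> \<longleftrightarrow> (\<forall>a c. r (bas (intv a a, intv c c)) =
     (let (p, q) = \<rho> (a, c) in bas (intv p p, intv q q)))"

definition act12 :: "('x \<times> 'x \<Rightarrow> 'x \<times> 'x) \<Rightarrow> 'x \<times> 'x \<times> 'x \<Rightarrow> 'x \<times> 'x \<times> 'x" where
  "act12 \<rho> = (\<lambda>(x, y, z). let (x', y') = \<rho> (x, y) in (x', y', z))"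

definition act23 :: "('x \<times> 'x \<Rightarrow> 'x \<times> 'x) \<Rightarrow> 'x \<times> 'x \<times> 'x \<Rightarrow> 'x \<times> 'x \<times> 'x" where
  "act23 \<rho> = (\<lambda>(x, y, z). let (y', z') = \<rho> (y, z) in (x, y', z'))"

definition set_braid :: "('x \<times> 'x \<Rightarrow> 'x \<times> 'x) \<Rightarrow> bool" where
  "set_braid \<rho> \<longleftrightarrow> act12 \<rho> \<circ> act23 \<rho> \<circ> act12 \<rho> = act23 \<rho> \<circ> act12 \<rho> \<circ> act23 \<rho>"

text \<open>With \<open>\<rho> (a, c) = (\<^sup>ac, a\<^sup>c)\<close>.\<close>

definition set_nondegenerate :: "('x \<times> 'x \<Rightarrow> 'x \<times> 'x) \<Rightarrow> bool" where
  "set_nondegenerate \<rho> \<longleftrightarrow> bij \<rho> \<and>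
     (\<forall>a. bij (\<lambda>c. fst (\<rho> (a, c)))) \<and> (\<forall>c. bij (\<lambda>a. snd (\<rho> (a, c))))"

text \<open>The coefficient of \<open>(e,f) \<otimes> (g,h)\<close> in \<open>r ((a,b) \<otimes> (c,d))\<close>.\<close>

definition lam :: "(('x::order, 'k::field) incidence2 \<Rightarrow> ('x, 'k) incidence2)
    \<Rightarrow> 'x \<Rightarrow> 'x \<Rightarrow> 'x \<Rightarrow> 'x \<Rightarrow> 'x \<Rightarrow> 'x \<Rightarrow> 'x \<Rightarrow> 'x \<Rightarrow> 'k" where
  "lam r a b c d e f g h =
     Poly_Mapping.lookup (r (bas (intv a b, intv c d))) (intv e f, intv g h)"

text \<open>The arguments \<open>l\<close> and \<open>m\<close> are the order automorphisms \<open>\<phi>\<^sub>l\<close> and \<open>\<phi>\<^sub>r\<close>.\<close>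

definition alpha_r :: "(('x::order, 'k::field) incidence2 \<Rightarrow> ('x, 'k) incidence2)
    \<Rightarrow> ('x \<Rightarrow> 'x) \<Rightarrow> ('x \<Rightarrow> 'x) \<Rightarrow> 'x \<Rightarrow> 'x \<Rightarrow> 'x \<Rightarrow> 'k" where
  "alpha_r r l m s a b = lam r a b s s (l s) (l s) (m a) (m b)"

definition beta_r :: "(('x::order, 'k::field) incidence2 \<Rightarrow> ('x, 'k) incidence2)
    \<Rightarrow> ('x \<Rightarrow> 'x) \<Rightarrow> ('x \<Rightarrow> 'x) \<Rightarrow> 'x \<Rightarrow> 'x \<Rightarrow> 'x \<Rightarrow> 'k" where
  "beta_r r l m s a b = lam r a b s s (l s) (l s) (m a) (m a)"

definition alpha_l :: "(('x::order, 'k::field) incidence2 \<Rightarrow> ('x, 'k) incidence2)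
    \<Rightarrow> ('x \<Rightarrow> 'x) \<Rightarrow> ('x \<Rightarrow> 'x) \<Rightarrow> 'x \<Rightarrow> 'x \<Rightarrow> 'x \<Rightarrow> 'k" where
  "alpha_l r l m s a b = lam r s s a b (l a) (l b) (m s) (m s)"

definition beta_l :: "(('x::order, 'k::field) incidence2 \<Rightarrow> ('x, 'k) incidence2)
    \<Rightarrow> ('x \<Rightarrow> 'x) \<Rightarrow> ('x \<Rightarrow> 'x) \<Rightarrow> 'x \<Rightarrow> 'x \<Rightarrow> 'x \<Rightarrow> 'k" where
  "beta_l r l m s a b = lam r s s a b (l a) (l a) (m s) (m s)"

text \<open>\<open>shifted \<phi> i f s a b\<close> is \<open>f\<^sup>(\<^sup>i\<^sup>)(s)\<close> for the cover \<open>a \<prec> b\<close>; here \<open>\<phi>\<close> is \<open>\<phi>\<^sub>r\<close> for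
  \<open>f = \<alpha>\<^sub>r, \<beta>\<^sub>r\<close> and \<open>\<phi>\<^sub>l\<close> for \<open>f = \<alpha>\<^sub>l, \<beta>\<^sub>l\<close>.\<close>

definition shifted :: "('x \<Rightarrow> 'x) \<Rightarrow> nat \<Rightarrow> ('x \<Rightarrow> 'x \<Rightarrow> 'x \<Rightarrow> 'k) \<Rightarrow> 'x \<Rightarrow> 'x \<Rightarrow> 'x \<Rightarrow> 'k" where
  "shifted \<phi> i f s a b = f ((\<phi> ^^ i) s) ((\<phi> ^^ i) a) ((\<phi> ^^ i) b)"

definition aligned :: "'k::field \<times> 'k \<Rightarrow> 'k \<times> 'k \<Rightarrow> bool" (infix \<open>\<sim>\<close> 50) where
  "v \<sim> v' \<longleftrightarrow> fst v * snd v' - snd v * fst v' = 0"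

definition primitive_root :: "nat \<Rightarrow> 'k::field \<Rightarrow> bool" where
  "primitive_root n w \<longleftrightarrow> w ^ n = 1 \<and> (\<forall>k. 0 < k \<and> k < n \<longrightarrow> w ^ k \<noteq> 1)"

text \<open>The product of \<open>C(a\<^sup>(\<^sup>u\<^sup>), b\<^sup>(\<^sup>u\<^sup>))\<^bsup>n-u-1\<^esup>\<close> over \<open>0 \<le> u \<le> n - 2\<close>.  Here and below a range
  \<open>0 \<le> u \<le> j - 2\<close> is written \<open>u < j - 1\<close>, which is empty for the natural numbers \<open>j \<le> 1\<close>.\<close>

definition gamma_pow :: "('x \<Rightarrow> 'x) \<Rightarrow> ('x \<Rightarrow> 'x \<Rightarrow> 'k::field) \<Rightarrow> nat \<Rightarrow> 'x \<Rightarrow> 'x \<Rightarrow> 'k" where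
  "gamma_pow \<phi> C n a b = (\<Prod>u<n-1. C ((\<phi> ^^ u) a) ((\<phi> ^^ u) b) ^ (n - u - 1))"

text \<open>The coefficients \<open>\<wp>\<^sub>j\<close> (for \<open>\<phi> = \<phi>\<^sub>r\<close>, \<open>C = C\<^sub>r\<close>) and \<open>\<ell>\<^sub>j\<close> (for \<open>\<phi> = \<phi>\<^sub>l\<close>, \<open>C = C\<^sub>l\<close>),
  where \<open>g\<close> is the chosen root \<open>\<gamma>\<^sub>r\<close> resp. \<open>\<gamma>\<^sub>l\<close>.\<close>

definition weight :: "('x \<Rightarrow> 'x) \<Rightarrow> ('x \<Rightarrow> 'x \<Rightarrow> 'k::field) \<Rightarrow> 'k \<Rightarrow> nat \<Rightarrow> nat \<Rightarrow> 'x \<Rightarrow> 'x \<Rightarrow> 'k" where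
  "weight \<phi> C g n j a b = 1 / g ^ (j + 1)
     * (\<Prod>u<n-1. C ((\<phi> ^^ u) a) ((\<phi> ^^ u) b))
     * (\<Prod>u<j-1. C ((\<phi> ^^ u) a) ((\<phi> ^^ u) b) ^ (j - u - 1))"

end

theory Submission
  imports Defs "HOL-Computational_Algebra.Polynomial"
begin

text \<open>Nonvanishing of \<open>\<alpha>\<^sub>r\<close> and \<open>\<alpha>\<^sub>l\<close>: for \<open>a \<prec> b\<close> the element \<open>(a,b) \<otimes> (s,s)\<close> is skew primitive, so its
  image is a combination of two group-likes and one cover; without the cover it would be the image
  of a combination of group-likes, against injectivity of \<open>r\<close>.  The equations of the four parts are
  instances of a single one for two commuting bijections.  Putting \<open>e = \<phi> s\<close> and, for the invariance,
  \<open>e = \<phi> c\<close> settles \<open>\<alpha>\<close>.  For \<open>\<beta>\<close> the equations along the \<open>\<phi>\<close>-orbit of a cover, scaled by the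
  weights, form a cyclic linear system with constant coefficients, which the discrete Fourier
  transform diagonalises into the alignment conditions.\<close>

section \<open>Coefficients of linear extensions and tensors\<close>

lemma lookup_bas: "Poly_Mapping.lookup (bas x) y = (if x = y then 1 else 0)"
  by (simp add: bas_def lookup_single when_def)

lemma lookup_lin_ext:
  "Poly_Mapping.lookup (lin_ext h u) y =
    (\<Sum>x\<in>Poly_Mapping.keys u. Poly_Mapping.lookup u x * Poly_Mapping.lookup (h x) y)"
  by (simp add: lin_ext_def lookup_sum)

text \<open>Meant for a coefficient to which a single basis vector \<open>z\<close> contributes; if
  \<open>z\<close> is outside the support of \<open>u\<close>, both sides are 0.\<close>

lemma lookup_lin_ext_delta:
  assumes "\<And>x. Poly_Mapping.lookup (h x) y = (if x = z then t else 0)"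
  shows "Poly_Mapping.lookup (lin_ext h u) y = Poly_Mapping.lookup u z * t"
proof -
  have "Poly_Mapping.lookup (lin_ext h u) y =
      (\<Sum>x\<in>Poly_Mapping.keys u. if x = z then Poly_Mapping.lookup u z * t else 0)"
    unfolding lookup_lin_ext assms by (rule sum.cong) auto
  then show ?thesis by (simp add: in_keys_iff)
qed

text \<open>Provides a common index set on which extensions of vectors with different supports can
  be compared.\<close>

lemma lookup_lin_ext_superset:
  assumes "finite S" "Poly_Mapping.keys u \<subseteq> S"
  shows "Poly_Mapping.lookup (lin_ext h u) y =
    (\<Sum>x\<in>S. Poly_Mapping.lookup u x * Poly_Mapping.lookup (h x) y)"
  unfolding lookup_lin_ext
  by (rule sum.mono_neutral_left) (use assms in \<open>auto simp: in_keys_iff\<close>)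

lemma lin_ext_bas [simp]: "lin_ext h (bas x) = h x"
  by (rule poly_mapping_eqI) (simp add: lookup_lin_ext bas_def)

lemma lin_ext_zero [simp]: "lin_ext h 0 = 0"
  by (simp add: lin_ext_def)

lemma lin_ext_add: "lin_ext h (u + v) = lin_ext h u + lin_ext h v"
proof (rule poly_mapping_eqI)
  fix y
  let ?S = "Poly_Mapping.keys u \<union> Poly_Mapping.keys v"
  have "Poly_Mapping.keys (u + v) \<subseteq> ?S" by (rule Poly_Mapping.keys_add)
  then show "Poly_Mapping.lookup (lin_ext h (u + v)) y =
      Poly_Mapping.lookup (lin_ext h u + lin_ext h v) y"
    by (simp add: lookup_add lookup_lin_ext_superset[where S = ?S] algebra_simps sum.distrib)
qed

lemma lin_ext_sum: "lin_ext h (sum f A) = (\<Sum>i\<in>A. lin_ext h (f i))"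
  by (induction A rule: infinite_finite_induct) (auto simp: lin_ext_add)

lemma lookup_tensor [simp]:
  "Poly_Mapping.lookup (tensor u v) (x, y) = Poly_Mapping.lookup u x * Poly_Mapping.lookup v y"
proof -
  have "Poly_Mapping.lookup (lin_ext (\<lambda>b. bas (a, b)) v) (x, y) =
      (if a = x then Poly_Mapping.lookup v y else 0)" for a
    using lookup_lin_ext_delta[of "\<lambda>b. bas (a, b)" "(x, y)" y "if a = x then 1 else 0" v]
    by (auto simp: lookup_bas)
  then show ?thesis
    unfolding tensor_def by (rule lookup_lin_ext_delta)
qed

lemma tensor_bas: "tensor (bas x) (bas y) = bas (x, y)"
  by (simp add: tensor_def)

lemma tensor_sum_left: "tensor (sum f A) v = (\<Sum>i\<in>A. tensor (f i) v)"
  by (simp add: tensor_def lin_ext_sum)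

lemma tensor_sum_right: "tensor u (sum f A) = (\<Sum>i\<in>A. tensor u (f i))"
  \<comment> \<open>\<open>tensor\<close> is a linear extension in its first argument only, so
    linearity in the second is checked on coefficients.\<close>
  by (rule poly_mapping_eqI) (auto simp: lookup_sum sum_distrib_left)

section \<open>Intervals and the coproduct on pairs of intervals\<close>

lemma Rep_intv_intv: "a \<le> b \<Longrightarrow> Rep_intv (intv a b) = (a, b)"
  by (simp add: intv_def Abs_intv_inverse)

lemma intv_eq_iff: "a \<le> b \<Longrightarrow> c \<le> d \<Longrightarrow> intv a b = intv c d \<longleftrightarrow> a = c \<and> b = d"
  by (metis Rep_intv_intv prod.inject)

lemma intv_cases:
  obtains a b where "a \<le> b" "i = intv a b"
proof -
  obtain a b where ab: "Rep_intv i = (a, b)" by force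
  with Rep_intv[of i] have "a \<le> b" by auto
  moreover have "i = intv a b" using ab by (metis Rep_intv_inverse intv_def)
  ultimately show thesis using that by blast
qed

lemma comult2_bas:
  assumes "a \<le> b" "c \<le> d"
  shows "comult2 (bas (intv a b, intv c d) :: ('x::order, 'k::field) incidence2) =
    (\<Sum>x\<in>{a..b}. \<Sum>y\<in>{c..d}. bas ((intv a x, intv c y), (intv x b, intv y d)))"
  using assms
  by (simp add: comult2_def tensor_map_def comult_def Rep_intv_intv tensor_sum_left
      tensor_sum_right tensor_bas mid_swap_def lin_ext_sum)

lemma lin_ext_vscale: "lin_ext h (vscale t u) = vscale t (lin_ext h u)"
proof (rule poly_mapping_eqI)
  fix y
  have "Poly_Mapping.keys (vscale t u) \<subseteq> Poly_Mapping.keys u"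
    by (auto simp: in_keys_iff)
  then show "Poly_Mapping.lookup (lin_ext h (vscale t u)) y =
      Poly_Mapping.lookup (vscale t (lin_ext h u)) y"
    by (simp add: lookup_lin_ext_superset[where S = "Poly_Mapping.keys u"]
        sum_distrib_left mult.assoc)
qed

lemma lin_ext_lin_ext: "lin_ext g (lin_ext h u) = lin_ext (\<lambda>x. lin_ext g (h x)) u"
  by (simp add: lin_ext_def[of h] lin_ext_sum lin_ext_vscale) (simp add: lin_ext_def)

lemma comult2_eq_lin_ext: "comult2 u = lin_ext (\<lambda>x. comult2 (bas x)) u"
  by (simp add: comult2_def mid_swap_def tensor_map_def lin_ext_lin_ext)

text \<open>The two halves of a splitting determine both the basis element and the points where it
  was split. So this term occurs in the coproduct of exactly one basis element, with coefficient
  1.\<close>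

lemma lookup_comult2:
  fixes v :: "('x::order, 'k::field) incidence2"
  assumes fin: "locally_finite TYPE('x)"
    and "a \<le> x" "x \<le> b" "c \<le> y" "y \<le> d"
  shows "Poly_Mapping.lookup (comult2 v) ((intv a x, intv c y), (intv x b, intv y d)) =
    Poly_Mapping.lookup v (intv a b, intv c d)"
proof -
  have le: "a \<le> b" "c \<le> d" using assms by auto
  have fin': "finite {p..q}" for p q :: 'x using fin by (auto simp: locally_finite_def)
  have "Poly_Mapping.lookup (comult2 (bas k :: ('x, 'k) incidence2))
      ((intv a x, intv c y), (intv x b, intv y d)) = (if k = (intv a b, intv c d) then 1 else 0)" for k
  proof -
    obtain i j where k: "k = (i, j)" by force
    obtain p q where i: "p \<le> q" "i = intv p q" by (rule intv_cases)
    obtain p' q' where j: "p' \<le> q'" "j = intv p' q'" by (rule intv_cases)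
    let ?K = "if p = a \<and> q = b \<and> p' = c \<and> q' = d then 1 else 0 :: 'k"
    have "Poly_Mapping.lookup (comult2 (bas k :: ('x, 'k) incidence2))
        ((intv a x, intv c y), (intv x b, intv y d)) =
      (\<Sum>u\<in>{p..q}. \<Sum>v\<in>{p'..q'}. if u = x \<and> v = y then ?K else 0)"
      using i j k assms(2-)
      by (auto simp: comult2_bas lookup_sum lookup_bas intv_eq_iff intro!: sum.cong)
    also have "\<dots> = (\<Sum>u\<in>{p..q}. if u = x then \<Sum>v\<in>{p'..q'}. if v = y then ?K else 0 else 0)"
      by (intro sum.cong) auto
    \<comment> \<open>If \<open>?K\<close> is 1, then \<open>x\<close> and \<open>y\<close> lie in
      the index intervals; otherwise every summand is 0.\<close>
    also have "\<dots> = ?K"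
      using assms(2-) fin' by simp
    finally show ?thesis using i j k le by (simp add: intv_eq_iff)
  qed
  from lookup_lin_ext_delta[OF this, of v] show ?thesis
    by (simp flip: comult2_eq_lin_ext)
qed

section \<open>Skew-primitive elements and covers\<close>

text \<open>A \<open>(P, Q)\<close>-primitive element is supported on the points \<open>P\<close>, \<open>Q\<close> and the interval from
  \<open>P\<close> to \<open>Q\<close>: split a basis element of its support at either endpoint.\<close>

lemma skew_primitive_support:
  fixes v :: "('x::order, 'k::field) incidence2"
  assumes fin: "locally_finite TYPE('x)"
    and prim: "comult2 v =
      tensor (bas (intv p p, intv q q)) v + tensor v (bas (intv p' p', intv q' q'))"
    and nz: "Poly_Mapping.lookup v (i, j) \<noteq> 0"
  shows "(i, j) \<in> {(intv p p, intv q q), (intv p' p', intv q' q'), (intv p p', intv q q')}"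
proof -
  obtain a b where i: "a \<le> b" "i = intv a b" by (rule intv_cases)
  obtain c d where j: "c \<le> d" "j = intv c d" by (rule intv_cases)
  \<comment> \<open>The splitting at the left end shows that this end is \<open>P\<close> or that
    \<open>(i, j)\<close> is \<open>Q\<close>; the one at the right end shows that this end is
    \<open>Q\<close> or that \<open>(i, j)\<close> is \<open>P\<close>. If \<open>(i, j)\<close> is
    neither point, both of its ends are thus known.\<close>
  show ?thesis
    using nz i j lookup_comult2[OF fin, of a a b c c d v] lookup_comult2[OF fin, of a b b c d d v]
    unfolding prim
    by (auto simp: lookup_add lookup_bas intv_eq_iff split: if_splits)
qed

lemma linear_map_add: "linear_map f \<Longrightarrow> f (u + v) = f u + f v"
  by (simp add: linear_map_def Vector_Spaces.linear_iff)

lemma linear_map_vscale: "linear_map f \<Longrightarrow> f (vscale t u) = vscale t (f u)"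
  by (simp add: linear_map_def Vector_Spaces.linear_iff)

text \<open>An abstract \<open>k\<close> serves both tensor orders: the cover is the left factor for
  \<alpha>r and the right factor for \<alpha>l.\<close>

lemma coalgebra_automorphism_top_coeff_nonzero:
  fixes r :: "('x::order, 'k::field) incidence2 \<Rightarrow> ('x, 'k) incidence2"
  assumes fin: "locally_finite TYPE('x)" and r: "coalgebra_automorphism r"
    and prim: "comult2 (bas k :: ('x, 'k) incidence2) = bas (P, k) + bas (k, Q)"
    and PQ: "k \<noteq> P" "k \<noteq> Q"
    and rP: "r (bas P) = bas (intv p p, intv q q)"
    and rQ: "r (bas Q) = bas (intv p' p', intv q' q')"
  shows "Poly_Mapping.lookup (r (bas k)) (intv p p', intv q q') \<noteq> 0"
proof
  define v where "v = r (bas k)"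
  assume "Poly_Mapping.lookup (r (bas k)) (intv p p', intv q q') = 0"
  then have top: "Poly_Mapping.lookup v (intv p p', intv q q') = 0" by (simp add: v_def)
  have lin: "linear_map r" and inj: "inj r"
    using r by (auto simp: coalgebra_automorphism_def bij_def)
  have "comult2 v = tensor_map r r (comult2 (bas k))"
    using r by (simp add: v_def coalgebra_automorphism_def fun_eq_iff)
  also have "\<dots> = tensor (r (bas P)) v + tensor v (r (bas Q))"
    by (simp add: prim tensor_map_def lin_ext_add v_def)
  finally have supp: "x \<in> {(intv p p, intv q q), (intv p' p', intv q' q')}"
    if "Poly_Mapping.lookup v x \<noteq> 0" for x
    using skew_primitive_support[OF fin, of v p q p' q'] that top by (cases x) (auto simp: rP rQ)
  \<comment> \<open>If \<open>P\<close> and \<open>Q\<close> have the same image, using its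
    coefficient for both would count it twice; then \<open>t\<close> is 0.\<close>
  obtain s t where "v = vscale s (r (bas P)) + vscale t (r (bas Q))"
  proof (cases "(intv p p, intv q q) = (intv p' p', intv q' q')")
    case True
    have "v = vscale (Poly_Mapping.lookup v (intv p p, intv q q)) (r (bas P)) + vscale 0 (r (bas Q))"
      by (rule poly_mapping_eqI) (use supp True in \<open>auto simp: rP rQ lookup_add lookup_bas\<close>)
    then show ?thesis by (rule that)
  next
    case False
    have "v = vscale (Poly_Mapping.lookup v (intv p p, intv q q)) (r (bas P))
        + vscale (Poly_Mapping.lookup v (intv p' p', intv q' q')) (r (bas Q))"
      by (rule poly_mapping_eqI) (use supp False in \<open>auto simp: rP rQ lookup_add lookup_bas\<close>)
    then show ?thesis by (rule that)
  qed
  then have "r (bas k) = r (vscale s (bas P) + vscale t (bas Q))"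
    by (simp add: v_def linear_map_add[OF lin] linear_map_vscale[OF lin])
  then have "bas k = vscale s (bas P) + vscale t (bas Q)"
    using inj by (simp add: inj_eq)
  \<comment> \<open>Comparison of the coefficients at \<open>k\<close> yields 1 = 0, as
    \<open>k\<close> differs from \<open>P\<close> and \<open>Q\<close>.\<close>
  then have "Poly_Mapping.lookup (bas k :: ('x, 'k) incidence2) k =
      Poly_Mapping.lookup (vscale s (bas P) + vscale t (bas Q)) k" by simp
  then show False using PQ by (simp add: lookup_add lookup_bas)
qed

lemma alpha_nonzero:
  fixes r :: "('x::order, 'k::field) incidence2 \<Rightarrow> ('x, 'k) incidence2"
  assumes fin: "locally_finite TYPE('x)" and r: "coalgebra_automorphism r"
    and grp: "\<And>a c. r (bas (intv a a, intv c c)) = bas (intv (l c) (l c), intv (m a) (m a))"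
    and cov: "a \<prec> b"
  shows alpha_r_nonzero: "alpha_r r l m s a b \<noteq> 0" and alpha_l_nonzero: "alpha_l r l m s a b \<noteq> 0"
proof -
  have ab: "a \<le> b" "a \<noteq> b" "{a..b} = {a, b}"
    using cov by (auto simp: covers_def)
  \<comment> \<open>A cover has no interior points, so only the splittings at its two ends
    remain.\<close>
  have "comult2 (bas (intv a b, intv s s) :: ('x, 'k) incidence2) =
      bas ((intv a a, intv s s), (intv a b, intv s s)) + bas ((intv a b, intv s s), (intv b b, intv s s))"
    using ab by (simp add: comult2_bas)
  then show "alpha_r r l m s a b \<noteq> 0"
    unfolding alpha_r_def lam_def
    by (rule coalgebra_automorphism_top_coeff_nonzero[OF fin r _ _ _ grp grp])
      (use ab in \<open>auto simp: intv_eq_iff\<close>)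
  have "comult2 (bas (intv s s, intv a b) :: ('x, 'k) incidence2) =
      bas ((intv s s, intv a a), (intv s s, intv a b)) + bas ((intv s s, intv a b), (intv s s, intv b b))"
    using ab by (simp add: comult2_bas)
  then show "alpha_l r l m s a b \<noteq> 0"
    unfolding alpha_l_def lam_def
    by (rule coalgebra_automorphism_top_coeff_nonzero[OF fin r _ _ _ grp grp])
      (use ab in \<open>auto simp: intv_eq_iff\<close>)
qed

lemma covers_order_automorphism:
  assumes "order_automorphism \<phi>" "a \<prec> b"
  shows "\<phi> a \<prec> \<phi> b"
proof -
  have le: "\<And>x y. \<phi> x \<le> \<phi> y \<longleftrightarrow> x \<le> y" and surj: "surj \<phi>"
    using assms(1) by (auto simp: order_automorphism_def bij_def)
  have "\<phi> a < \<phi> b" using assms(2) by (simp add: covers_def less_le_not_le le)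
  moreover have "{\<phi> a..\<phi> b} = \<phi> ` {a..b}"
  proof (intro equalityI subsetI)
    fix y assume y: "y \<in> {\<phi> a..\<phi> b}"
    obtain x where "y = \<phi> x" using surj by blast
    with y show "y \<in> \<phi> ` {a..b}" by (simp add: le)
  qed (auto simp: le)
  ultimately show ?thesis using assms(2) by (simp add: covers_def)
qed

section \<open>Discrete Fourier transform over a field\<close>

text \<open>Equality of two powers with exponents i < j would cancel to
  \<open>w ^ (j - i) = 1\<close> with 0 < j - i < n.\<close>

lemma primitive_root_inj_on:
  fixes w :: "'k::field"
  assumes "n \<ge> 1" "primitive_root n w"
  shows "inj_on (\<lambda>i. w ^ i) {..<n}"
proof (rule linorder_inj_onI)
  fix i j assume ij: "i < j" "i \<in> {..<n}" "j \<in> {..<n}"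
  have "w \<noteq> 0" using assms by (auto simp: primitive_root_def power_0_left)
  moreover have "w ^ j = w ^ i * w ^ (j - i)"
    using ij by (simp flip: power_add)
  moreover have "w ^ (j - i) \<noteq> 1" using assms ij by (auto simp: primitive_root_def)
  ultimately show "w ^ i \<noteq> w ^ j" by auto
qed auto

text \<open>The transform lists the values of the polynomial with coefficients \<open>d\<close> at
  the n distinct powers of \<open>w\<close>. Its degree is below n, so root counting replaces the
  inversion formula.\<close>

lemma dft_eq_zero_iff:
  fixes w :: "'k::field"
  assumes "n \<ge> 1" "primitive_root n w"
  shows "(\<forall>i<n. (\<Sum>j<n. w ^ (i * j) * d j) = 0) \<longleftrightarrow> (\<forall>j<n. d j = 0)"
proof
  assume *: "\<forall>i<n. (\<Sum>j<n. w ^ (i * j) * d j) = 0"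
  define p where "p = (\<Sum>j<n. monom (d j) j)"
  have root: "poly p (w ^ i) = 0" if "i < n" for i
    using * that by (simp add: p_def poly_sum poly_monom power_mult mult.commute)
  have "p = 0"
  proof (rule ccontr)
    assume "p \<noteq> 0"
    have "n = card ((\<lambda>i. w ^ i) ` {..<n})"
      using primitive_root_inj_on[OF assms] by (simp add: card_image)
    also have "\<dots> \<le> card {x. poly p x = 0}"
      by (intro card_mono poly_roots_finite \<open>p \<noteq> 0\<close>) (auto simp: root)
    also have "\<dots> \<le> degree p" by (rule card_poly_roots_bound) fact
    also have "degree p \<le> n - 1"
      unfolding p_def by (intro degree_sum_le) (auto intro: order_trans[OF degree_monom_le])
    finally show False using \<open>n \<ge> 1\<close> by simp
  qed
  moreover have "coeff p j = d j" if "j < n" for j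
    using that by (simp add: p_def coeff_sum)
  ultimately show "\<forall>j<n. d j = 0" by (metis coeff_0)
qed simp

text \<open>Shifting the index of a periodic sequence multiplies its \<open>i\<close>-th Fourier coefficient by
  \<open>w\<^bsup>-i\<^esup>\<close>, so each coefficient of the left-hand side is a \<open>2 \<times> 2\<close> determinant.\<close>

lemma periodic_cross_iff_aligned_dft:
  fixes w x y :: "'k::field"
  assumes n: "n \<ge> 1" and w: "primitive_root n w" and per: "b n = b 0" "b' n = b' 0"
  shows "(\<forall>j<n. b j + x * b' (Suc j) = b' j + y * b (Suc j)) \<longleftrightarrow>
    (\<forall>i<n. (x - w ^ i, \<Sum>j<n. w ^ (i * j) * b j) \<sim> (y - w ^ i, \<Sum>j<n. w ^ (i * j) * b' j))"
proof -
  have w0: "w \<noteq> 0" using assms by (auto simp: primitive_root_def power_0_left)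
  define d where "d j = b j + x * b' (Suc j) - (b' j + y * b (Suc j))" for j
  have shift: "w ^ i * (\<Sum>j<n. w ^ (i * j) * f (Suc j)) = (\<Sum>j<n. w ^ (i * j) * f j)"
    if f: "f n = f 0" for i and f :: "nat \<Rightarrow> 'k"
  proof -
    have wn: "w ^ (i * n) = 1"
      using w by (metis mult.commute power_mult power_one primitive_root_def)
    have "w ^ i * (\<Sum>j<n. w ^ (i * j) * f (Suc j)) = (\<Sum>j<n. w ^ (i * Suc j) * f (Suc j))"
      by (simp add: sum_distrib_left power_add mult.assoc)
    \<comment> \<open>The term at 0 is added to complete the range; the last term, at n, equals it
      by periodicity and \<open>w ^ (i * n) = 1\<close>, and both cancel.\<close>
    also have "\<dots> + w ^ (i * 0) * f 0 = (\<Sum>j<Suc n. w ^ (i * j) * f j)"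
      by (subst sum.lessThan_Suc_shift) simp
    also have "\<dots> = (\<Sum>j<n. w ^ (i * j) * f j) + f 0"
      using f wn by simp
    finally show ?thesis by simp
  qed
  have "(x - w ^ i, \<Sum>j<n. w ^ (i * j) * b j) \<sim> (y - w ^ i, \<Sum>j<n. w ^ (i * j) * b' j) \<longleftrightarrow>
      (\<Sum>j<n. w ^ (i * j) * d j) = 0" for i
  proof -
    have scale: "W * D = W * B + x * (W * P) - (W * B' + y * (W * Q))"
      if "D = B + x * P - (B' + y * Q)" for W D B P B' Q :: 'k
      by (simp add: that algebra_simps)
    let ?F = "\<lambda>f. \<Sum>j<n. w ^ (i * j) * f j"
    have "?F d = ?F b + x * ?F (\<lambda>j. b' (Suc j)) - (?F b' + y * ?F (\<lambda>j. b (Suc j)))"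
      by (simp add: d_def algebra_simps sum.distrib sum_subtractf sum_distrib_left)
    then have "w ^ i * ?F d = w ^ i * ?F b + x * (w ^ i * ?F (\<lambda>j. b' (Suc j)))
        - (w ^ i * ?F b' + y * (w ^ i * ?F (\<lambda>j. b (Suc j))))"
      by (rule scale)
    \<comment> \<open>After multiplication by the nonzero factor \<open>w ^ i\<close> the shifted
      transforms become unshifted ones, and the expression is the determinant in
      \<open>aligned\<close>.\<close>
    also have "\<dots> = (x - w ^ i) * ?F b' - ?F b * (y - w ^ i)"
      unfolding shift[of b, OF per(1)] shift[of b', OF per(2)] by (simp add: algebra_simps)
    finally show ?thesis using w0 unfolding aligned_def
      by (metis fst_conv snd_conv mult_eq_0_iff power_not_zero)
  qed
  then have "(\<forall>i<n. (x - w ^ i, \<Sum>j<n. w ^ (i * j) * b j) \<sim> (y - w ^ i, \<Sum>j<n. w ^ (i * j) * b' j))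
      \<longleftrightarrow> (\<forall>j<n. d j = 0)"
    using dft_eq_zero_iff[OF n w, of d] by simp
  then show ?thesis by (simp add: d_def)
qed

section \<open>The equation for \<alpha>\<close>

lemma alpha_equation_iff:
  fixes \<alpha> :: "'x::order \<Rightarrow> 'x \<Rightarrow> 'x \<Rightarrow> 'k::field"
  assumes surj: "surj \<phi>"
    and nz: "\<And>s a b. a \<prec> b \<Longrightarrow> \<alpha> s a b \<noteq> 0"
    and cov: "\<And>a b. a \<prec> b \<Longrightarrow> \<phi> a \<prec> \<phi> b"
  shows "(\<forall>a b c e. a \<prec> b \<longrightarrow>
      \<alpha> c a b * \<alpha> e (\<phi> a) (\<phi> b) = \<alpha> (\<psi> e) a b * \<alpha> (\<phi> c) (\<phi> a) (\<phi> b)) \<longleftrightarrow>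
    (\<forall>a b. a \<prec> b \<longrightarrow> (\<exists>C. C \<noteq> 0 \<and>
      (\<forall>s. shifted \<phi> 1 \<alpha> s a b / \<alpha> s a b = C \<and> \<alpha> s a b = \<alpha> (\<psi> (\<phi> s)) a b)))"
    (is "?L \<longleftrightarrow> ?R")
proof
  assume L: ?L
  show ?R
  proof (intro allI impI)
    fix a b :: 'x assume ab: "a \<prec> b"
    have L': "\<alpha> c a b * \<alpha> e (\<phi> a) (\<phi> b) = \<alpha> (\<psi> e) a b * \<alpha> (\<phi> c) (\<phi> a) (\<phi> b)" for c e
      using L ab by blast
    have inv: "\<alpha> s a b = \<alpha> (\<psi> (\<phi> s)) a b" for s
      using L'[of s "\<phi> s"] nz[OF cov[OF ab]] by simp
    \<comment> \<open>Any fixed element could replace \<phi> a here: the right-hand side does not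
      involve s and serves as the constant C.\<close>
    have "shifted \<phi> 1 \<alpha> s a b / \<alpha> s a b = \<alpha> (\<phi> a) (\<phi> a) (\<phi> b) / \<alpha> (\<psi> (\<phi> a)) a b" for s
      using L'[of s "\<phi> a"] nz[OF ab] by (simp add: shifted_def frac_eq_eq mult.commute)
    moreover have "\<alpha> (\<phi> a) (\<phi> a) (\<phi> b) / \<alpha> (\<psi> (\<phi> a)) a b \<noteq> 0"
      using nz[OF ab] nz[OF cov[OF ab]] by simp
    ultimately show "\<exists>C. C \<noteq> 0 \<and>
      (\<forall>s. shifted \<phi> 1 \<alpha> s a b / \<alpha> s a b = C \<and> \<alpha> s a b = \<alpha> (\<psi> (\<phi> s)) a b)"
      using inv by blast
  qed
next
  assume R: ?R
  show ?L
  proof (intro allI impI)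
    fix a b c e :: 'x assume ab: "a \<prec> b"
    obtain C where C: "\<And>s. shifted \<phi> 1 \<alpha> s a b / \<alpha> s a b = C"
      "\<And>s. \<alpha> s a b = \<alpha> (\<psi> (\<phi> s)) a b"
      using R ab by blast
    have \<phi>: "\<alpha> (\<phi> s) (\<phi> a) (\<phi> b) = C * \<alpha> s a b" for s
      using C(1)[of s] nz[OF ab, of s] by (simp add: shifted_def field_simps)
    \<comment> \<open>With e = \<phi> e', both sides equal C times \<alpha> c a b times \<alpha> e'
      a b.\<close>
    obtain e' where e: "e = \<phi> e'" using surj by blast
    show "\<alpha> c a b * \<alpha> e (\<phi> a) (\<phi> b) = \<alpha> (\<psi> e) a b * \<alpha> (\<phi> c) (\<phi> a) (\<phi> b)"
      unfolding e \<phi> C(2)[symmetric] by simp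
  qed
qed

section \<open>Weights and the equation for \<beta>\<close>

text \<open>With \<open>A\<^sub>j = C\<^sub>0 \<cdots> C\<^bsub>j-1\<^esub>\<close> (so \<open>\<alpha>\<^sup>(\<^sup>j\<^sup>) = A\<^sub>j \<alpha>\<close>), the weights are determined up to a scalar by
  the recursion \<open>weight\<^bsub>j+1\<^esub> = weight\<^sub>j A\<^sub>j / \<gamma>\<close>; the condition on \<open>\<gamma>\<close> makes them \<open>n\<close>-periodic.\<close>

lemma weight_Suc:
  "weight \<phi> C g n (Suc j) a b =
    weight \<phi> C g n j a b * (\<Prod>u<j. C ((\<phi> ^^ u) a) ((\<phi> ^^ u) b)) / g"
proof -
  let ?c = "\<lambda>u. C ((\<phi> ^^ u) a) ((\<phi> ^^ u) b)"
  have "(\<Prod>u<j. ?c u ^ (j - u)) = (\<Prod>u<j. ?c u ^ (j - u - 1) * ?c u)"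
    by (intro prod.cong) (auto simp flip: power_Suc2 simp: Suc_diff_Suc)
  also have "\<dots> = (\<Prod>u<j. ?c u ^ (j - u - 1)) * (\<Prod>u<j. ?c u)"
    by (rule prod.distrib)
  \<comment> \<open>The additional factor u = j - 1 has exponent 0.\<close>
  also have "(\<Prod>u<j. ?c u ^ (j - u - 1)) = (\<Prod>u<j-1. ?c u ^ (j - u - 1))"
    by (cases j) auto
  finally show ?thesis by (simp add: weight_def mult_ac)
qed

text \<open>At j = n the last product in \<open>weight\<close> is \<open>gamma_pow\<close>, that is
  \<open>g ^ n\<close>, which reduces \<open>1 / g ^ (n + 1)\<close> to \<open>1 / g\<close>; at j =
  0 that product is empty.\<close>

lemma weight_period:
  assumes "g ^ n = gamma_pow \<phi> C n a b" "g \<noteq> 0"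
  shows "weight \<phi> C g n n a b = weight \<phi> C g n 0 a b"
proof -
  have "weight \<phi> C g n n a b = 1 / g ^ (n + 1) * (\<Prod>u<n-1. C ((\<phi> ^^ u) a) ((\<phi> ^^ u) b)) * g ^ n"
    by (simp only: weight_def gamma_pow_def assms(1))
  then show ?thesis using assms(2) by (simp add: weight_def)
qed

lemma shifted_period: "\<phi> ^^ n = id \<Longrightarrow> shifted \<phi> n f = shifted \<phi> 0 f"
  by (simp add: shifted_def fun_eq_iff)

text \<open>The case e = \<phi> c isolates the invariance of \<beta>. What remains is an equation
  symmetric in two points s and t; its translates along the orbit of a cover form the cyclic system
  to which the Fourier criterion applies.\<close>

lemma beta_equation_iff:
  fixes \<alpha> \<beta> :: "'x::order \<Rightarrow> 'x \<Rightarrow> 'x \<Rightarrow> 'k::field" and C \<gamma> :: "'x \<Rightarrow> 'x \<Rightarrow> 'k"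
  assumes n: "n \<ge> 1" and w: "primitive_root n w"
    and surj: "surj \<phi>" and per: "\<phi> ^^ n = id"
    and cov: "\<And>a b. a \<prec> b \<Longrightarrow> \<phi> a \<prec> \<phi> b"
    and C: "\<forall>a b. a \<prec> b \<longrightarrow> C a b \<noteq> 0 \<and>
      (\<forall>s. shifted \<phi> 1 \<alpha> s a b / \<alpha> s a b = C a b \<and> \<alpha> s a b = \<alpha> (\<psi> (\<phi> s)) a b)"
    and \<gamma>: "\<forall>a b. a \<prec> b \<longrightarrow> \<gamma> a b ^ n = gamma_pow \<phi> C n a b"
  shows "(\<forall>a b c e. a \<prec> b \<longrightarrow>
      \<beta> c a b + \<alpha> c a b * \<beta> e (\<phi> a) (\<phi> b)
        = \<beta> (\<psi> e) a b + \<alpha> (\<psi> e) a b * \<beta> (\<phi> c) (\<phi> a) (\<phi> b)) \<longleftrightarrow>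
    (\<forall>s a b. a \<prec> b \<longrightarrow> \<beta> s a b = \<beta> (\<psi> (\<phi> s)) a b) \<and>
    (\<forall>a b s t i. a \<prec> b \<longrightarrow> i < n \<longrightarrow>
      (\<gamma> a b * \<alpha> s a b - w ^ i,
       \<Sum>j<n. weight \<phi> C (\<gamma> a b) n j a b * w ^ (i * j) * shifted \<phi> j \<beta> s a b)
      \<sim>
      (\<gamma> a b * \<alpha> t a b - w ^ i,
       \<Sum>j<n. weight \<phi> C (\<gamma> a b) n j a b * w ^ (i * j) * shifted \<phi> j \<beta> t a b))"
    (is "?L \<longleftrightarrow> ?I \<and> ?A")
proof -
  have inv: "\<alpha> s a b = \<alpha> (\<psi> (\<phi> s)) a b" if "a \<prec> b" for s a b :: 'x
    using C that by blast
  have Cnz: "C a b \<noteq> 0" if "a \<prec> b" for a b :: 'x using C that by blast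
  have step: "\<alpha> (\<phi> s) (\<phi> a) (\<phi> b) = C a b * \<alpha> s a b" if "a \<prec> b" for s a b :: 'x
  proof -
    have "\<alpha> (\<phi> s) (\<phi> a) (\<phi> b) / \<alpha> s a b = C a b"
    proof -
      have "shifted \<phi> 1 \<alpha> s a b / \<alpha> s a b = C a b" using C that by blast
      then show ?thesis by (simp add: shifted_def)
    qed
    \<comment> \<open>Division by zero gives 0, so a nonzero quotient forces a nonzero
      denominator.\<close>
    moreover from this have "\<alpha> s a b \<noteq> 0" using Cnz[OF that] by auto
    ultimately show ?thesis by (simp add: field_simps)
  qed
  have covj: "(\<phi> ^^ j) a \<prec> (\<phi> ^^ j) b" if "a \<prec> b" for a b :: 'x and j
    using that by (induction j) (auto intro: cov)
  \<comment> \<open>This is the equation for c = s and e = \<phi> t, simplified by invariance and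
    moved j steps along the orbit.\<close>
  define E where "E s t j a b \<longleftrightarrow>
    shifted \<phi> j \<beta> s a b + shifted \<phi> j \<alpha> s a b * shifted \<phi> (Suc j) \<beta> t a b =
    shifted \<phi> j \<beta> t a b + shifted \<phi> j \<alpha> t a b * shifted \<phi> (Suc j) \<beta> s a b" for s t j a b
  have E_shift: "E s t j a b \<longleftrightarrow> E ((\<phi> ^^ j) s) ((\<phi> ^^ j) t) 0 ((\<phi> ^^ j) a) ((\<phi> ^^ j) b)" for s t j a b
    by (simp add: E_def shifted_def)
  have L_iff: "?L \<longleftrightarrow> ?I \<and> (\<forall>s t a b. a \<prec> b \<longrightarrow> E s t 0 a b)"
  proof (intro iffI conjI)
    assume L: ?L
    show I: ?I
    proof (intro allI impI)
      fix s a b :: 'x assume "a \<prec> b"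
      then show "\<beta> s a b = \<beta> (\<psi> (\<phi> s)) a b"
        \<comment> \<open>For e = \<phi> s the two products agree by invariance of \<alpha> and
          cancel.\<close>
        using L[rule_format, of a b s "\<phi> s"] inv[of a b s] by simp
    qed
    show "\<forall>s t a b. a \<prec> b \<longrightarrow> E s t 0 a b"
    proof (intro allI impI)
      fix s t a b :: 'x assume ab: "a \<prec> b"
      have "\<beta> (\<psi> (\<phi> t)) a b = \<beta> t a b"
        by (rule sym) (use I ab in blast)
      then show "E s t 0 a b"
        using L[rule_format, OF ab, of s "\<phi> t"] inv[OF ab, of t] by (simp add: E_def shifted_def)
    qed
  next
    assume R: "?I \<and> (\<forall>s t a b. a \<prec> b \<longrightarrow> E s t 0 a b)"
    show ?L
    proof (intro allI impI)
      fix a b c e :: 'x assume ab: "a \<prec> b"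
      obtain t where e: "e = \<phi> t" using surj by blast
      have "\<beta> (\<psi> (\<phi> t)) a b = \<beta> t a b"
        by (rule sym) (use R ab in blast)
      moreover have "E c t 0 a b" using R ab by blast
      ultimately show "\<beta> c a b + \<alpha> c a b * \<beta> e (\<phi> a) (\<phi> b)
        = \<beta> (\<psi> e) a b + \<alpha> (\<psi> e) a b * \<beta> (\<phi> c) (\<phi> a) (\<phi> b)"
        using inv[OF ab, of t] by (simp add: E_def shifted_def e)
    qed
  qed
  have A_iff: "(\<forall>i<n. (\<gamma> a b * \<alpha> s a b - w ^ i,
       \<Sum>j<n. weight \<phi> C (\<gamma> a b) n j a b * w ^ (i * j) * shifted \<phi> j \<beta> s a b)
      \<sim>
      (\<gamma> a b * \<alpha> t a b - w ^ i,
       \<Sum>j<n. weight \<phi> C (\<gamma> a b) n j a b * w ^ (i * j) * shifted \<phi> j \<beta> t a b)) \<longleftrightarrow>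
      (\<forall>j<n. E s t j a b)" if ab: "a \<prec> b" for s t a b
  proof -
    define A where "A j = (\<Prod>u<j. C ((\<phi> ^^ u) a) ((\<phi> ^^ u) b))" for j
    define p where "p j = weight \<phi> C (\<gamma> a b) n j a b" for j
    \<comment> \<open>The coefficient \<open>A j * \<alpha> s a b\<close> in equation j varies with
      j. Scaling by \<open>p j\<close> makes it the constant
      \<open>\<gamma> a b * \<alpha> s a b\<close>, because
      \<open>p j * A j = \<gamma> a b * p (Suc j)\<close>.\<close>
    define f where "f s j = p j * shifted \<phi> j \<beta> s a b" for s j
    have cnz: "C ((\<phi> ^^ u) a) ((\<phi> ^^ u) b) \<noteq> 0" for u
      using Cnz covj[OF ab] by blast
    have "\<gamma> a b ^ n \<noteq> 0" using \<gamma> ab cnz by (auto simp: gamma_pow_def)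
    then have g: "\<gamma> a b \<noteq> 0" using n by (auto simp: power_0_left)
    have p0: "p j \<noteq> 0" for j using cnz g by (simp add: p_def weight_def)
    have pS: "\<gamma> a b * p (Suc j) = p j * A j" for j
      using g by (simp add: p_def A_def weight_Suc)
    have \<alpha>: "shifted \<phi> j \<alpha> s a b = A j * \<alpha> s a b" for j s
    proof (induction j)
      case (Suc j)
      then show ?case
        using step[OF covj[OF ab], of "(\<phi> ^^ j) s" j] by (simp add: shifted_def A_def mult_ac)
    qed (simp add: shifted_def A_def)
    have f_per: "f s n = f s 0" for s
      using weight_period[of "\<gamma> a b" n \<phi> C a b] \<gamma> ab g shifted_period[OF per, of \<beta>]
      by (simp add: f_def p_def)
    have "E s t j a b \<longleftrightarrow>
      f s j + \<gamma> a b * \<alpha> s a b * f t (Suc j) = f t j + \<gamma> a b * \<alpha> t a b * f s (Suc j)" for j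
    proof -
      have "f s j + \<gamma> a b * \<alpha> s a b * f t (Suc j) =
          p j * (shifted \<phi> j \<beta> s a b + shifted \<phi> j \<alpha> s a b * shifted \<phi> (Suc j) \<beta> t a b)" for s t
      proof -
        have "f s j + \<gamma> a b * \<alpha> s a b * f t (Suc j) = p j * shifted \<phi> j \<beta> s a b
            + (\<gamma> a b * p (Suc j)) * (\<alpha> s a b * shifted \<phi> (Suc j) \<beta> t a b)"
          by (simp add: f_def mult_ac)
        then show ?thesis unfolding pS \<alpha> by (simp add: algebra_simps)
      qed
      then show ?thesis using p0[of j] by (simp add: E_def)
    qed
    then show ?thesis
      using periodic_cross_iff_aligned_dft[OF n w, of "f s" "f t" "\<gamma> a b * \<alpha> s a b" "\<gamma> a b * \<alpha> t a b"] f_per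
      by (simp add: f_def p_def mult_ac)
  qed
  have "?A \<longleftrightarrow> (\<forall>s t a b. a \<prec> b \<longrightarrow> (\<forall>j<n. E s t j a b))"
    using A_iff by blast
  \<comment> \<open>Equation j for a cover is equation 0 for its j-th translate, which is again a
    cover; so over all covers the two families are equivalent.\<close>
  also have "\<dots> \<longleftrightarrow> (\<forall>s t a b. a \<prec> b \<longrightarrow> E s t 0 a b)"
  proof (intro iffI allI impI)
    fix s t a b :: 'x assume "\<forall>s t a b. a \<prec> b \<longrightarrow> (\<forall>j<n. E s t j a b)" "a \<prec> b"
    then show "E s t 0 a b" using n by simp
  next
    fix s t a b :: 'x and j assume "\<forall>s t a b. a \<prec> b \<longrightarrow> E s t 0 a b" "a \<prec> b"
    then show "E s t j a b" using covj by (simp add: E_shift[of s t j])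
  qed
  finally show ?thesis using L_iff by blast
qed

section \<open>Instances of the general equations for the right and left actions\<close>

theorem proposition4p5:
  fixes r :: "('x::order, 'k::field) incidence2 \<Rightarrow> ('x, 'k) incidence2"
    and \<rho> :: "'x \<times> 'x \<Rightarrow> 'x \<times> 'x"
    and \<phi>l \<phi>r :: "'x \<Rightarrow> 'x"
    and n :: nat
    and w :: 'k
  defines "\<alpha>r \<equiv> alpha_r r \<phi>l \<phi>r" and "\<beta>r \<equiv> beta_r r \<phi>l \<phi>r"
    and "\<alpha>l \<equiv> alpha_l r \<phi>l \<phi>r" and "\<beta>l \<equiv> beta_l r \<phi>l \<phi>r"
  assumes "locally_finite TYPE('x)"
    and "coalgebra_automorphism r" and "nondegenerate r"
    and "induces r \<rho>" and "set_nondegenerate \<rho>" and "set_braid \<rho>"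
    and "order_automorphism \<phi>l" and "order_automorphism \<phi>r"
    and "\<phi>l \<circ> \<phi>r = \<phi>r \<circ> \<phi>l"
    and "\<And>x. (\<lambda>c. fst (\<rho> (x, c))) = \<phi>l" and "\<And>y. (\<lambda>a. snd (\<rho> (a, y))) = \<phi>r"
    and "n \<ge> 1"
    and "\<phi>r ^^ n = id" and "\<phi>l ^^ n = id"
    and "\<And>y::'k. y \<noteq> 0 \<Longrightarrow> card {x. x ^ n = y} = n"
    and "primitive_root n w"
  shows
    "((\<forall>a b c e. a \<prec> b \<longrightarrow>
         \<alpha>r c a b * \<alpha>r e (\<phi>r a) (\<phi>r b) = \<alpha>r (\<phi>l e) a b * \<alpha>r (\<phi>r c) (\<phi>r a) (\<phi>r b))
      \<longleftrightarrow>
      (\<forall>a b. a \<prec> b \<longrightarrow> (\<exists>C. C \<noteq> 0 \<and>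
         (\<forall>s. shifted \<phi>r 1 \<alpha>r s a b / \<alpha>r s a b = C \<and> \<alpha>r s a b = \<alpha>r (\<phi>l (\<phi>r s)) a b))))
     \<and>
     ((\<forall>e f a c. e \<prec> f \<longrightarrow>
         \<alpha>l (\<phi>r a) e f * \<alpha>l (\<phi>l c) (\<phi>l e) (\<phi>l f) = \<alpha>l c e f * \<alpha>l a (\<phi>l e) (\<phi>l f))
      \<longleftrightarrow>
      (\<forall>a b. a \<prec> b \<longrightarrow> (\<exists>C. C \<noteq> 0 \<and>
         (\<forall>s. shifted \<phi>l 1 \<alpha>l s a b / \<alpha>l s a b = C \<and> \<alpha>l s a b = \<alpha>l (\<phi>l (\<phi>r s)) a b))))
     \<and>
     (\<forall>Cr \<gamma>r :: 'x \<Rightarrow> 'x \<Rightarrow> 'k.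
      (\<forall>a b. a \<prec> b \<longrightarrow> Cr a b \<noteq> 0 \<and>
         (\<forall>s. shifted \<phi>r 1 \<alpha>r s a b / \<alpha>r s a b = Cr a b \<and> \<alpha>r s a b = \<alpha>r (\<phi>l (\<phi>r s)) a b))
      \<longrightarrow> (\<forall>a b. a \<prec> b \<longrightarrow> \<gamma>r a b ^ n = gamma_pow \<phi>r Cr n a b)
      \<longrightarrow>
      ((\<forall>a b c e. a \<prec> b \<longrightarrow>
          \<beta>r c a b + \<alpha>r c a b * \<beta>r e (\<phi>r a) (\<phi>r b)
            = \<beta>r (\<phi>l e) a b + \<alpha>r (\<phi>l e) a b * \<beta>r (\<phi>r c) (\<phi>r a) (\<phi>r b))
       \<longleftrightarrow>
       (\<forall>s a b. a \<prec> b \<longrightarrow> \<beta>r s a b = \<beta>r (\<phi>l (\<phi>r s)) a b) \<and>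
       (\<forall>a b s t i. a \<prec> b \<longrightarrow> i < n \<longrightarrow>
          (\<gamma>r a b * \<alpha>r s a b - w ^ i,
           \<Sum>j<n. weight \<phi>r Cr (\<gamma>r a b) n j a b * w ^ (i * j) * shifted \<phi>r j \<beta>r s a b)
          \<sim>
          (\<gamma>r a b * \<alpha>r t a b - w ^ i,
           \<Sum>j<n. weight \<phi>r Cr (\<gamma>r a b) n j a b * w ^ (i * j) * shifted \<phi>r j \<beta>r t a b))))
     \<and>
     (\<forall>Cl \<gamma>l :: 'x \<Rightarrow> 'x \<Rightarrow> 'k.
      (\<forall>a b. a \<prec> b \<longrightarrow> Cl a b \<noteq> 0 \<and>
         (\<forall>s. shifted \<phi>l 1 \<alpha>l s a b / \<alpha>l s a b = Cl a b \<and> \<alpha>l s a b = \<alpha>l (\<phi>l (\<phi>r s)) a b))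
      \<longrightarrow> (\<forall>a b. a \<prec> b \<longrightarrow> \<gamma>l a b ^ n = gamma_pow \<phi>l Cl n a b)
      \<longrightarrow>
      ((\<forall>e f a c. e \<prec> f \<longrightarrow>
          \<beta>l (\<phi>r a) e f + \<alpha>l (\<phi>r a) e f * \<beta>l (\<phi>l c) (\<phi>l e) (\<phi>l f)
            = \<beta>l c e f + \<alpha>l c e f * \<beta>l a (\<phi>l e) (\<phi>l f))
       \<longleftrightarrow>
       (\<forall>s a b. a \<prec> b \<longrightarrow> \<beta>l s a b = \<beta>l (\<phi>l (\<phi>r s)) a b) \<and>
       (\<forall>a b s t i. a \<prec> b \<longrightarrow> i < n \<longrightarrow>
          (\<gamma>l a b * \<alpha>l s a b - w ^ i,
           \<Sum>j<n. weight \<phi>l Cl (\<gamma>l a b) n j a b * w ^ (i * j) * shifted \<phi>l j \<beta>l s a b)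
          \<sim>
          (\<gamma>l a b * \<alpha>l t a b - w ^ i,
           \<Sum>j<n. weight \<phi>l Cl (\<gamma>l a b) n j a b * w ^ (i * j) * shifted \<phi>l j \<beta>l t a b))))"
proof -
  have grp: "r (bas (intv a a, intv c c)) =
      bas (intv (\<phi>l c) (\<phi>l c), intv (\<phi>r a) (\<phi>r a))" for a c
  proof -
    have "\<rho> (a, c) = (\<phi>l c, \<phi>r a)"
      using fun_cong[OF assms(14)[of a], of c] fun_cong[OF assms(15)[of c], of a] by (simp add: prod_eq_iff)
    then show ?thesis using \<open>induces r \<rho>\<close> by (simp add: induces_def)
  qed
  have nz_r: "\<alpha>r s a b \<noteq> 0" and nz_l: "\<alpha>l s a b \<noteq> 0" if "a \<prec> b" for s a b
    unfolding \<alpha>r_def \<alpha>l_def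
    using alpha_nonzero[OF \<open>locally_finite TYPE('x)\<close> \<open>coalgebra_automorphism r\<close> grp that] by auto
  have surj: "surj \<phi>l" "surj \<phi>r"
    using \<open>order_automorphism \<phi>l\<close> \<open>order_automorphism \<phi>r\<close>
    by (auto simp: order_automorphism_def bij_def)
  note cov_l = covers_order_automorphism[OF \<open>order_automorphism \<phi>l\<close>]
  note cov_r = covers_order_automorphism[OF \<open>order_automorphism \<phi>r\<close>]
  note lr = \<open>\<phi>l \<circ> \<phi>r = \<phi>r \<circ> \<phi>l\<close>
  have comm: "\<phi>r (\<phi>l s) = \<phi>l (\<phi>r s)" for s
    using fun_cong[OF lr, of s] by simp
  note beta = beta_equation_iff[OF \<open>n \<ge> 1\<close> \<open>primitive_root n w\<close>]
  have 1: "(\<forall>a b c e. a \<prec> b \<longrightarrow>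
         \<alpha>r c a b * \<alpha>r e (\<phi>r a) (\<phi>r b) = \<alpha>r (\<phi>l e) a b * \<alpha>r (\<phi>r c) (\<phi>r a) (\<phi>r b))
      \<longleftrightarrow>
      (\<forall>a b. a \<prec> b \<longrightarrow> (\<exists>C. C \<noteq> 0 \<and>
         (\<forall>s. shifted \<phi>r 1 \<alpha>r s a b / \<alpha>r s a b = C \<and> \<alpha>r s a b = \<alpha>r (\<phi>l (\<phi>r s)) a b)))"
    by (rule alpha_equation_iff[OF surj(2) nz_r cov_r])
  have 2: "(\<forall>e f a c. e \<prec> f \<longrightarrow>
         \<alpha>l (\<phi>r a) e f * \<alpha>l (\<phi>l c) (\<phi>l e) (\<phi>l f) = \<alpha>l c e f * \<alpha>l a (\<phi>l e) (\<phi>l f))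
      \<longleftrightarrow>
      (\<forall>a b. a \<prec> b \<longrightarrow> (\<exists>C. C \<noteq> 0 \<and>
         (\<forall>s. shifted \<phi>l 1 \<alpha>l s a b / \<alpha>l s a b = C \<and> \<alpha>l s a b = \<alpha>l (\<phi>l (\<phi>r s)) a b)))"
    (is "?L \<longleftrightarrow> _")
  proof -
    \<comment> \<open>This is the general equation with \<phi> = \<phi>l and \<psi> = \<phi>r once
      its sides are exchanged; \<open>a\<close> takes the role of \<open>e\<close>, and the cover is
      named \<open>e\<close>, \<open>f\<close>.\<close>
    have "?L \<longleftrightarrow> (\<forall>e f c a. e \<prec> f \<longrightarrow>
        \<alpha>l c e f * \<alpha>l a (\<phi>l e) (\<phi>l f) = \<alpha>l (\<phi>r a) e f * \<alpha>l (\<phi>l c) (\<phi>l e) (\<phi>l f))"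
      by (intro iffI allI impI; rule sym; blast)
    also note alpha_equation_iff[OF surj(1) nz_l cov_l, where \<psi> = \<phi>r, unfolded comm]
    finally show ?thesis .
  qed
  show ?thesis
  proof (intro conjI allI impI)
    fix Cr \<gamma>r :: "'x \<Rightarrow> 'x \<Rightarrow> 'k"
    assume "\<forall>a b. a \<prec> b \<longrightarrow> Cr a b \<noteq> 0 \<and>
         (\<forall>s. shifted \<phi>r 1 \<alpha>r s a b / \<alpha>r s a b = Cr a b \<and> \<alpha>r s a b = \<alpha>r (\<phi>l (\<phi>r s)) a b)"
      "\<forall>a b. a \<prec> b \<longrightarrow> \<gamma>r a b ^ n = gamma_pow \<phi>r Cr n a b"
    from beta[OF surj(2) \<open>\<phi>r ^^ n = id\<close> cov_r this, of \<beta>r]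
    show "(\<forall>a b c e. a \<prec> b \<longrightarrow>
          \<beta>r c a b + \<alpha>r c a b * \<beta>r e (\<phi>r a) (\<phi>r b)
            = \<beta>r (\<phi>l e) a b + \<alpha>r (\<phi>l e) a b * \<beta>r (\<phi>r c) (\<phi>r a) (\<phi>r b))
       \<longleftrightarrow>
       (\<forall>s a b. a \<prec> b \<longrightarrow> \<beta>r s a b = \<beta>r (\<phi>l (\<phi>r s)) a b) \<and>
       (\<forall>a b s t i. a \<prec> b \<longrightarrow> i < n \<longrightarrow>
          (\<gamma>r a b * \<alpha>r s a b - w ^ i,
           \<Sum>j<n. weight \<phi>r Cr (\<gamma>r a b) n j a b * w ^ (i * j) * shifted \<phi>r j \<beta>r s a b)
          \<sim>
          (\<gamma>r a b * \<alpha>r t a b - w ^ i,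
           \<Sum>j<n. weight \<phi>r Cr (\<gamma>r a b) n j a b * w ^ (i * j) * shifted \<phi>r j \<beta>r t a b))" .
  next
    fix Cl \<gamma>l :: "'x \<Rightarrow> 'x \<Rightarrow> 'k"
    assume Cl: "\<forall>a b. a \<prec> b \<longrightarrow> Cl a b \<noteq> 0 \<and>
         (\<forall>s. shifted \<phi>l 1 \<alpha>l s a b / \<alpha>l s a b = Cl a b \<and> \<alpha>l s a b = \<alpha>l (\<phi>l (\<phi>r s)) a b)"
      and \<gamma>l: "\<forall>a b. a \<prec> b \<longrightarrow> \<gamma>l a b ^ n = gamma_pow \<phi>l Cl n a b"
    have "(\<forall>e f a c. e \<prec> f \<longrightarrow>
          \<beta>l (\<phi>r a) e f + \<alpha>l (\<phi>r a) e f * \<beta>l (\<phi>l c) (\<phi>l e) (\<phi>l f)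
            = \<beta>l c e f + \<alpha>l c e f * \<beta>l a (\<phi>l e) (\<phi>l f)) \<longleftrightarrow>
        (\<forall>e f c a. e \<prec> f \<longrightarrow>
          \<beta>l c e f + \<alpha>l c e f * \<beta>l a (\<phi>l e) (\<phi>l f)
            = \<beta>l (\<phi>r a) e f + \<alpha>l (\<phi>r a) e f * \<beta>l (\<phi>l c) (\<phi>l e) (\<phi>l f))"
      by (intro iffI allI impI; rule sym; blast)
    \<comment> \<open>The general statement composes the maps as \<phi>r (\<phi>l s), so
      \<open>comm\<close> is folded into the hypothesis and unfolded in the result.\<close>
    also note beta[OF surj(1) \<open>\<phi>l ^^ n = id\<close> cov_l Cl[folded comm] \<gamma>l, of \<beta>l, unfolded comm]
    finally show "(\<forall>e f a c. e \<prec> f \<longrightarrow>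
          \<beta>l (\<phi>r a) e f + \<alpha>l (\<phi>r a) e f * \<beta>l (\<phi>l c) (\<phi>l e) (\<phi>l f)
            = \<beta>l c e f + \<alpha>l c e f * \<beta>l a (\<phi>l e) (\<phi>l f))
       \<longleftrightarrow>
       (\<forall>s a b. a \<prec> b \<longrightarrow> \<beta>l s a b = \<beta>l (\<phi>l (\<phi>r s)) a b) \<and>
       (\<forall>a b s t i. a \<prec> b \<longrightarrow> i < n \<longrightarrow>
          (\<gamma>l a b * \<alpha>l s a b - w ^ i,
           \<Sum>j<n. weight \<phi>l Cl (\<gamma>l a b) n j a b * w ^ (i * j) * shifted \<phi>l j \<beta>l s a b)
          \<sim>
          (\<gamma>l a b * \<alpha>l t a b - w ^ i,
           \<Sum>j<n. weight \<phi>l Cl (\<gamma>l a b) n j a b * w ^ (i * j) * shifted \<phi>l j \<beta>l t a b))" .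
  qed (fact 1 2)+
qed

end
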